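(* Fix $n\ge 1$ and a peeling algorithm $\mathfrak{a}$. If $\mathcal{T}_n$ is a uniform Cayley tree of size $n$ rooted at the vertex $n$, then the peeling exploration $(\mathbf{F}_i^{\mathfrak{a}})_{0\le i\le n-1}$ of $\mathcal{T}_n$ with algorithm $\mathfrak{a}$ is a Markov chain whose transition probabilities are as follows. For $0\le i\le n-2$, conditionally on $\mathbf{F}_i^{\mathfrak{a}}$ and $\mathfrak{a}(\mathbf{F}_i^{\mathfrak{a}})$, let $m\ge 1$ be the number of vertices of the connected component of $\mathfrak{a}(\mathbf{F}_i^{\mathfrak{a}})$ in $\mathbf{F}_i^{\mathfrak{a}}$ and let $\ell\ge 1$ be the number of blue vertices of $\mathbf{F}_i^{\mathfrak{a}}$. 1. For every blue vertex $v$, the parent of $\mathfrak{a}(\mathbf{F}_i^{\mathfrak{a}})$ is $v$ with probability $\frac{\ell+m}{\ell n}$, and in that case $\mathbf{F}_{i+1}^{\mathfrak{a}}$ is obtained by adding an edge from $\mathfrak{a}(\mathbf{F}_i^{\mathfrak{a}})$ to $v$ and coloring the resulting component blue. 2. For every white vertex $v$ which does not belong to the component of $\mathfrak{a}(\mathbf{F}_i^{\mathfrak{a}})$, the parent of $\mathfrak{a}(\mathbf{F}_i^{\mathfrak{a}})$ is $v$ with probability $\frac1n$, and in that case $\mathbf{F}_{i+1}^{\mathfrak{a}}$ is obtained by adding an edge from $\mathfrak{a}(\mathbf{F}_i^{\mathfrak{a}})$ to $v$ (the resulting component being white).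
   Context: A Cayley tree of size $n$ is an unordered tree on the labeled vertex set $\{1,\dots,n\}$; here it is always rooted at the vertex $n$, with all edges oriented towards the root, so every vertex other than $n$ has a parent. $\mathcal{T}_n$ is uniform among the $n^{n-2}$ such trees. For $0\le k\le n-1$, $\mathcal{F}^*(n,k)$ is the set of unordered rooted forests (each tree of the forest is rooted) on the labeled vertices $\{1,\dots,n\}$ with exactly $k$ edges in which one of the trees is distinguished; the distinguished tree and its vertices are called blue, the other trees and their vertices are called white. $\mathcal{F}_n^*=\bigcup_{k=0}^{n-1}\mathcal{F}^*(n,k)$. If $\mathbf{f}\in\mathcal{F}^*_n$, $v_1$ is the root of a white tree of $\mathbf{f}$ and $v_2$ is a vertex of another tree of $\mathbf{f}$, then $\mathbf{f}_{v_1\to v_2}$ is the forest obtained from $\mathbf{f}$ by adding an edge from $v_1$ to $v_2$ (making $v_2$ the parent of $v_1$) and coloring the resulting component with the color of $v_2$. A peeling algorithm is a (deterministic) function $\mathfrak{a}$ which associates with each $\mathbf{f}\in\mathcal{F}_n^*\setminus\mathcal{F}^*(n,n-1)$ the root of a white tree of $\mathbf{f}$. The peeling exploration of a Cayley tree $\mathbf{t}$ rooted at $n$ with algorithm $\mathfrak{a}$ is the sequence $\mathbf{F}_0^{\mathfrak{a}},\dots,\mathbf{F}_{n-1}^{\mathfrak{a}}$ defined as follows: $\mathbf{F}_0^{\mathfrak{a}}\in\mathcal{F}^*(n,0)$ consists of $n$ isolated vertices, all white except the vertex $n$, which is blue; for $1\le i\le n-1$, if $v$ is the parent of $\mathfrak{a}(\mathbf{F}_{i-1}^{\mathfrak{a}})$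 in $\mathbf{t}$, then $\mathbf{F}_i^{\mathfrak{a}}=(\mathbf{F}_{i-1}^{\mathfrak{a}})_{\mathfrak{a}(\mathbf{F}_{i-1}^{\mathfrak{a}})\to v}$. In the claim, "parent" means parent in $\mathcal{T}_n$. *)

theory Defs
  imports "HOL-Probability.Probability"
begin

(* A forest on {1..n} is the set of its oriented edges (child, parent). *)

definition component :: "(nat \<times> nat) set \<Rightarrow> nat \<Rightarrow> nat set" where
  "component E v = {u. (v, u) \<in> (E \<union> E\<inverse>)\<^sup>*}"

definition rooted_forest :: "nat \<Rightarrow> (nat \<times> nat) set \<Rightarrow> bool" where
  "rooted_forest n E \<longleftrightarrow> E \<subseteq> {1..n} \<times> {1..n} \<and> single_valued E \<and> acyclic E"

definition roots :: "nat \<Rightarrow> (nat \<times> nat) set \<Rightarrow> nat set" where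
  "roots n E = {1..n} - Domain E"

definition cayley_trees :: "nat \<Rightarrow> (nat \<times> nat) set set" where
  "cayley_trees n =
     {t. rooted_forest n t \<and> (\<forall>u\<in>{1..n}. \<forall>v\<in>{1..n}. v \<in> component t u) \<and> n \<in> roots n t}"

definition parent :: "(nat \<times> nat) set \<Rightarrow> nat \<Rightarrow> nat" where
  "parent t u = (THE v. (u, v) \<in> t)"

(* The next lemmas justify the encoding: each tree of a forest has exactly one root, its edges are
   directed towards it, and parent is well defined away from it. *)

lemma reaches_root:
  assumes "single_valued E" "r \<notin> Domain E" "r \<in> component E u"
  shows "(u, r) \<in> E\<^sup>*"
proof -
  have "(u, r) \<in> (E \<union> E\<inverse>)\<^sup>*" using assms(3) by (simp add: component_def)
  then show ?thesis
  proof (induction rule: converse_rtrancl_induct)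
    case base
    show ?case by simp
  next
    case (step u w)
    show ?case
    proof (cases "(u, w) \<in> E")
      case True
      then show ?thesis using step.IH by (rule converse_rtrancl_into_rtrancl)
    next
      case False
      then have wu: "(w, u) \<in> E" using step.hyps(1) by simp
      then have "w \<noteq> r" using assms(2) by blast
      then obtain x where x: "(w, x) \<in> E" "(x, r) \<in> E\<^sup>*"
        using step.IH by (metis converse_rtranclE)
      then have "x = u" using wu assms(1) by (metis single_valuedD)
      then show ?thesis using x by simp
    qed
  qed
qed

lemma component_ex1_root:
  assumes "rooted_forest n E" "u \<in> {1..n}"
  shows "\<exists>!r. r \<in> component E u \<inter> roots n E"
proof (rule ex_ex1I)
  have fin: "finite E"
    using assms(1) by (metis finite_SigmaI finite_atLeastAtMost finite_subset rooted_forest_def)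
  have "wf (E\<inverse>)"
    using fin assms(1) by (simp add: finite_acyclic_wf_converse rooted_forest_def)
  moreover have "u \<in> component E u \<inter> {1..n}"
    using assms(2) by (simp add: component_def)
  ultimately obtain r where r: "r \<in> component E u \<inter> {1..n}"
    and min: "\<And>y. (y, r) \<in> E\<inverse> \<Longrightarrow> y \<notin> component E u \<inter> {1..n}"
    by (rule wfE_min) blast
  have "r \<notin> Domain E"
  proof
    assume "r \<in> Domain E"
    then obtain y where y: "(r, y) \<in> E" by blast
    then have "y \<in> component E u"
      using r by (auto simp: component_def intro: rtrancl_into_rtrancl)
    moreover have "y \<in> {1..n}" using y assms(1) by (auto simp: rooted_forest_def)
    ultimately show False using min[of y] y by simp
  qed
  then show "\<exists>r. r \<in> component E u \<inter> roots n E" using r by (auto simp: roots_def)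
next
  fix r s
  assume r: "r \<in> component E u \<inter> roots n E" and s: "s \<in> component E u \<inter> roots n E"
  have sv: "single_valued E" using assms(1) by (simp add: rooted_forest_def)
  have "(u, r) \<in> E\<^sup>*" "(u, s) \<in> E\<^sup>*"
    using r s sv by (auto simp: roots_def intro: reaches_root)
  then have "(r, s) \<in> E\<^sup>* \<or> (s, r) \<in> E\<^sup>*"
    using sv by (metis single_valued_confluent)
  then show "r = s" using r s by (auto simp: roots_def elim: converse_rtranclE)
qed

lemma cayley_tree_parent:
  assumes "t \<in> cayley_trees n" "u \<in> {1..n}" "u \<noteq> n"
  shows "\<exists>!v. (u, v) \<in> t" "(u, n) \<in> t\<^sup>*"
proof -
  have sv: "single_valued t" using assms(1) by (simp add: cayley_trees_def rooted_forest_def)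
  show *: "(u, n) \<in> t\<^sup>*"
    using assms by (intro reaches_root) (auto simp: cayley_trees_def rooted_forest_def roots_def)
  then obtain v where "(u, v) \<in> t" using assms(3) by (metis converse_rtranclE)
  then show "\<exists>!v. (u, v) \<in> t" using sv by (metis single_valuedD)
qed

lemma finite_cayley_trees: "finite (cayley_trees n)"
proof (rule finite_subset)
  show "cayley_trees n \<subseteq> Pow ({1..n} \<times> {1..n})"
    by (auto simp: cayley_trees_def rooted_forest_def)
qed simp

lemma cayley_trees_nonempty:
  assumes "n \<ge> 1"
  shows "cayley_trees n \<noteq> {}"
proof -
  define t where "t = {1..<n} \<times> {n}"
  have "trans t" by (auto simp: t_def trans_def)
  then have "acyclic t" by (auto simp: acyclic_def t_def)
  have "(u, n) \<in> (t \<union> t\<inverse>)\<^sup>* \<and> (n, u) \<in> (t \<union> t\<inverse>)\<^sup>*" if "u \<in> {1..n}" for u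
  proof (cases "u = n")
    case False
    then have "(u, n) \<in> t" using that by (auto simp: t_def)
    then show ?thesis by blast
  qed simp
  then have "(u, v) \<in> (t \<union> t\<inverse>)\<^sup>*" if "u \<in> {1..n}" "v \<in> {1..n}" for u v
    using that by (meson rtrancl_trans)
  moreover have "n \<in> roots n t" "t \<subseteq> {1..n} \<times> {1..n}" "single_valued t"
    using assms by (auto simp: roots_def t_def single_valued_def)
  ultimately have "t \<in> cayley_trees n"
    using \<open>acyclic t\<close> by (simp add: cayley_trees_def rooted_forest_def component_def)
  then show ?thesis by blast
qed

(* The distinguished tree is given by its vertex set. *)

record marked_forest =
  edges :: "(nat \<times> nat) set"
  blue :: "nat set"

definition marked_forests :: "nat \<Rightarrow> nat \<Rightarrow> marked_forest set" where
  "marked_forests n k =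
     {f. rooted_forest n (edges f) \<and> card (edges f) = k \<and>
         (\<exists>v\<in>{1..n}. blue f = component (edges f) v)}"

definition all_marked_forests :: "nat \<Rightarrow> marked_forest set" where
  "all_marked_forests n = (\<Union>k\<in>{0..n-1}. marked_forests n k)"

definition white :: "nat \<Rightarrow> marked_forest \<Rightarrow> nat set" where
  "white n f = {1..n} - blue f"

(* attach f u v is used for u the root of a white tree and v a vertex of another tree;
   a white tree does not need any recording, so only a blue v changes the colouring. *)

definition attach :: "marked_forest \<Rightarrow> nat \<Rightarrow> nat \<Rightarrow> marked_forest" where
  "attach f u v =
     (let E = insert (u, v) (edges f)
      in \<lparr>edges = E, blue = (if v \<in> blue f then component E v else blue f)\<rparr>)"

definition peeling_algorithm :: "nat \<Rightarrow> (marked_forest \<Rightarrow> nat) \<Rightarrow> bool" where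
  "peeling_algorithm n a \<longleftrightarrow>
     (\<forall>f \<in> all_marked_forests n - marked_forests n (n - 1). a f \<in> white n f \<inter> roots n (edges f))"

(* Meaningful for indices up to n - 1. *)

primrec exploration ::
  "nat \<Rightarrow> (marked_forest \<Rightarrow> nat) \<Rightarrow> (nat \<times> nat) set \<Rightarrow> nat \<Rightarrow> marked_forest" where
  "exploration n a t 0 = \<lparr>edges = {}, blue = {n}\<rparr>"
| "exploration n a t (Suc i) =
     (let f = exploration n a t i in attach f (a f) (parent t (a f)))"

(* Discrete-time Markov chain, indexed by 0, ..., N, on a countable state space S. *)

definition markov_chain :: "'w measure \<Rightarrow> 's set \<Rightarrow> nat \<Rightarrow> (nat \<Rightarrow> 'w \<Rightarrow> 's) \<Rightarrow> bool" where
  "markov_chain M S N X \<longleftrightarrow>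
     prob_space M \<and> countable S \<and>
     (\<forall>i\<le>N. X i \<in> M \<rightarrow>\<^sub>M count_space S) \<and>
     (\<forall>i<N. \<forall>x. \<forall>s\<in>S.
        \<P>(\<omega> in M. \<forall>j\<le>i. X j \<omega> = x j) > 0 \<longrightarrow>
        \<P>(\<omega> in M. X (Suc i) \<omega> = s \<bar> \<forall>j\<le>i. X j \<omega> = x j) =
        \<P>(\<omega> in M. X (Suc i) \<omega> = s \<bar> X i \<omega> = x i))"

end

theory Submission
  imports Defs
begin

text \<open>
  The law of the exploration is a ratio of two tree counts, because knowing the current forest is
  the same as knowing that certain edges belong to the tree.

  Let $f$ be a forest that is reached after $i$ steps when exploring some Cayley tree. Its blue tree
  is the component of the root $n$, so its edges determine it completely. Moreover a Cayley tree
  \<open>t\<close> leads to $f$ after $i$ steps if and only if it contains all edges of $f$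
  (\<open>exploration_eq_iff\<close>): these edges include the ones revealed at every earlier step, so each
  step in \<open>t\<close> asks for the same vertex and gets the same answer. In particular the present
  forest determines the past ones, which makes the Markov property immediate: the two conditioning
  events coincide. Conditionally on the forest $f$ the tree is uniform among those
  containing the edges of $f$, and the probability that the peeled root $r$ has parent $v$ is the
  number of Cayley trees containing the edges of $f$ and $(r, v)$, divided by the number of those
  containing the edges of $f$.

  These numbers are given by \<open>card_trees_containing\<close>: a rooted forest in which $n$ is the root of
  a component with $\ell$ vertices, and which has $c$ further components, is contained in $N$ Cayley
  trees with $N n = \ell n^c$. The proof is by induction on $c$, classifying the trees by the parent
  $v$ of another root $r$, whose component has $m$ vertices, say. The $\ell$ choices of $v$ in the
  component of $n$ enlarge it to $\ell + m$ vertices, the $n - \ell - m$ choices outside both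
  components leave it alone, and
  $\ell (\ell + m) + (n - \ell - m) \ell = \ell n$. So the recursion closes without a prior
  enumeration of the Cayley trees, and the quotient of two counts is $(\ell + m) / (\ell n)$ if
  $v$ is blue and $1 / n$ if it is white.
\<close>

section \<open>Components of a forest\<close>

lemma component_refl [simp]: "x \<in> component E x"
  by (simp add: component_def)

lemma component_sym: "y \<in> component E x \<longleftrightarrow> x \<in> component E y"
  by (metis (no_types, lifting) component_def mem_Collect_eq symD sym_Un_converse sym_rtrancl)

lemma component_trans: "y \<in> component E x \<Longrightarrow> z \<in> component E y \<Longrightarrow> z \<in> component E x"
  by (auto simp: component_def)

lemma component_eq: "y \<in> component E x \<Longrightarrow> component E y = component E x"
  using component_sym component_trans by blast

lemma component_disjoint: "y \<notin> component E x \<Longrightarrow> component E x \<inter> component E y = {}"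
  using component_sym component_trans by blast

text \<open>
  Adding an edge merges the components of its two ends. The two ends enter symmetrically, so that the
  same equation serves for a component seen from either side of the new edge.
\<close>

lemma component_insert:
  "component (insert (u, v) E) x =
     (if u \<in> component E x \<or> v \<in> component E x
      then component E u \<union> component E v else component E x)"
proof -
  define S where "S = E \<union> E\<inverse>"
  have S: "insert (u, v) E \<union> (insert (u, v) E)\<inverse> = insert (u, v) (insert (v, u) S)"
    by (auto simp: S_def)
  \<comment> \<open>Expressed through equality of components, connectivity needs no symmetry or transitivity, and
    the claim becomes one of pure equational logic.\<close>
  have mem: "z \<in> component E y \<longleftrightarrow> component E y = component E z" for y z
    using component_eq component_refl by metis
  have conn: "(y, z) \<in> S\<^sup>* \<longleftrightarrow> component E y = component E z" for y z
    unfolding mem[symmetric] by (simp add: component_def S_def)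
  have "y \<in> component (insert (u, v) E) x \<longleftrightarrow>
      y \<in> (if u \<in> component E x \<or> v \<in> component E x
        then component E u \<union> component E v else component E x)" for y
    unfolding component_def[of "insert (u, v) E"] S rtrancl_insert
    by (simp only: mem_Collect_eq Un_iff prod.case conn mem if_split) metis
  then show ?thesis by blast
qed

lemma component_subset:
  assumes "E \<subseteq> {1..n} \<times> {1..n}" "x \<in> {1..n}"
  shows "component E x \<subseteq> {1..n}"
proof
  fix y assume "y \<in> component E x"
  then have "(x, y) \<in> (E \<union> E\<inverse>)\<^sup>*" by (simp add: component_def)
  then show "y \<in> {1..n}"
    by (induction rule: rtrancl_induct) (use assms in auto)
qed

lemma distinct_roots_not_connected:
  assumes "single_valued E" "r \<notin> Domain E" "s \<notin> Domain E" "r \<noteq> s"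
  shows "r \<notin> component E s"
proof
  assume "r \<in> component E s"
  then have "(s, r) \<in> E\<^sup>*" using assms by (intro reaches_root)
  then show False using assms(3,4) by (metis DomainI converse_rtranclE)
qed

section \<open>Forests and Cayley trees\<close>

lemma rooted_forest_finite: "rooted_forest n E \<Longrightarrow> finite E"
  by (metis finite_SigmaI finite_atLeastAtMost finite_subset rooted_forest_def)

lemma rooted_forest_subset:
  "rooted_forest n E' \<Longrightarrow> E \<subseteq> E' \<Longrightarrow> rooted_forest n E"
  unfolding rooted_forest_def
  by (meson acyclic_subset order_trans single_valued_subset)

lemma card_Domain_single_valued:
  assumes "single_valued E"
  shows "card (Domain E) = card E"
proof -
  have "inj_on fst E"
    using assms by (auto simp: inj_on_def single_valued_def)
  then show ?thesis by (simp add: Domain_fst card_image)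
qed

text \<open>
  Joining a root to a vertex outside its own tree cannot close a cycle, since a cycle would have to
  return from that vertex to the root.
\<close>

lemma rooted_forest_insert:
  assumes "rooted_forest n E" "r \<in> {1..n}" "v \<in> {1..n}" "r \<notin> Domain E" "v \<notin> component E r"
  shows "rooted_forest n (insert (r, v) E)"
proof -
  have "(v, r) \<notin> E\<^sup>*"
  proof
    assume "(v, r) \<in> E\<^sup>*"
    then have "r \<in> component E v"
      by (simp add: component_def rtrancl_mono[THEN subsetD, of E])
    then show False using assms(5) component_sym by blast
  qed
  then show ?thesis
    using assms by (auto simp: rooted_forest_def acyclic_insert single_valued_def)
qed

definition trees_containing :: "nat \<Rightarrow> (nat \<times> nat) set \<Rightarrow> (nat \<times> nat) set set" where
  "trees_containing n E = {t \<in> cayley_trees n. E \<subseteq> t}"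

lemma finite_trees_containing [simp]: "finite (trees_containing n E)"
  by (simp add: trees_containing_def finite_cayley_trees)

lemma cayley_tree_forest:
  assumes "t \<in> cayley_trees n"
  shows "rooted_forest n t" "n \<notin> Domain t"
  using assms by (auto simp: cayley_trees_def roots_def)

lemma parent_eq_iff:
  assumes "t \<in> cayley_trees n" "r \<in> {1..n}" "r \<noteq> n"
  shows "parent t r = v \<longleftrightarrow> (r, v) \<in> t"
  unfolding parent_def using cayley_tree_parent(1)[OF assms] by (metis the_equality)

text \<open>
  A root of a subforest that has a parent in a larger forest has it outside its own component: every
  vertex of the component has a path to the root, which the edge to the parent would close to a cycle.
\<close>

lemma parent_not_in_component:
  assumes "acyclic t" "single_valued t" "E \<subseteq> t" "(r, v) \<in> t" "r \<notin> Domain E"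
  shows "v \<notin> component E r"
proof
  assume "v \<in> component E r"
  then have "(v, r) \<in> E\<^sup>*"
    using assms by (intro reaches_root) (auto simp: component_sym intro: single_valued_subset)
  then have "(v, r) \<in> t\<^sup>*" using assms(3) rtrancl_mono by blast
  then show False using assms(1,4) by (meson acyclic_def rtrancl_into_trancl2)
qed

text \<open>
  The base case of the count. With $n - 1$ edges every vertex except $n$ has a parent, so all paths
  lead to $n$ and the forest is already a Cayley tree; no edge can be added to it.
\<close>

lemma spanning_forest:
  assumes "n \<ge> 1" "rooted_forest n E" "n \<notin> Domain E" "card E + 1 = n"
  shows "component E n = {1..n}" "trees_containing n E = {E}"
proof -
  have E: "E \<subseteq> {1..n} \<times> {1..n}" "single_valued E" "finite E"
    using assms(2) rooted_forest_finite by (auto simp: rooted_forest_def)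
  have Dom: "Domain E = {1..n} - {n}"
  proof (rule card_subset_eq)
    show "Domain E \<subseteq> {1..n} - {n}" using E assms(3) by auto
    show "card (Domain E) = card ({1..n} - {n})"
      using assms E by (simp add: card_Domain_single_valued)
  qed simp
  have conn: "n \<in> component E u" if u: "u \<in> {1..n}" for u
  proof -
    obtain r where "r \<in> component E u \<inter> roots n E"
      using component_ex1_root[OF assms(2) u] by blast
    moreover have "roots n E = {n}" using Dom assms(1) by (auto simp: roots_def)
    ultimately show ?thesis by auto
  qed
  have "{1..n} \<subseteq> component E n" using conn component_sym by blast
  then show "component E n = {1..n}"
    using component_subset[OF E(1), of n] assms(1) by auto
  have "E \<in> cayley_trees n"
    unfolding cayley_trees_def mem_Collect_eq
  proof (intro conjI ballI)
    show "v \<in> component E u" if "u \<in> {1..n}" "v \<in> {1..n}" for u v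
      using conn that component_trans component_sym by metis
    show "n \<in> roots n E" using assms(1,3) by (simp add: roots_def)
  qed fact
  moreover have "t = E" if t: "t \<in> cayley_trees n" "E \<subseteq> t" for t
  proof -
    have f: "rooted_forest n t" "n \<notin> Domain t" using t cayley_tree_forest by auto
    then have "Domain t \<subseteq> {1..n} - {n}" by (auto simp: rooted_forest_def)
    then have "card (Domain t) \<le> n - 1"
      using assms(1) card_mono[of "{1..n} - {n}" "Domain t"] by simp
    then have "card t \<le> card E"
      using f assms(4) by (simp add: card_Domain_single_valued rooted_forest_def)
    then show "t = E"
      using card_seteq[OF rooted_forest_finite[OF f(1)] t(2)] by simp
  qed
  ultimately show "trees_containing n E = {E}" by (auto simp: trees_containing_def)
qed

text \<open>
  The recursion for the count: the trees are classified by the parent of a fixed root of the forest.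
\<close>

lemma card_trees_containing_split:
  assumes "rooted_forest n E" "r \<in> {1..n}" "r \<noteq> n" "r \<notin> Domain E"
  shows "card (trees_containing n E) =
    (\<Sum>v\<in>{1..n} - component E r. card (trees_containing n (insert (r, v) E)))"
proof -
  have "trees_containing n E =
      (\<Union>v\<in>{1..n} - component E r. trees_containing n (insert (r, v) E))" (is "?L = ?R")
  proof (intro equalityI subsetI)
    fix t assume t: "t \<in> ?L"
    then have tc: "t \<in> cayley_trees n" and sub: "E \<subseteq> t" by (auto simp: trees_containing_def)
    obtain v where v: "(r, v) \<in> t" using cayley_tree_parent(1)[OF tc assms(2,3)] by blast
    have "v \<in> {1..n}" "v \<notin> component E r"
      using cayley_tree_forest(1)[OF tc] v sub parent_not_in_component[OF _ _ sub v assms(4)]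
      by (auto simp: rooted_forest_def)
    then show "t \<in> ?R" using tc sub v by (auto simp: trees_containing_def)
  qed (auto simp: trees_containing_def)
  moreover have "card ?R = (\<Sum>v\<in>{1..n} - component E r. card (trees_containing n (insert (r, v) E)))"
  proof (rule card_UN_disjoint)
    show "\<forall>v\<in>{1..n} - component E r. \<forall>w\<in>{1..n} - component E r. v \<noteq> w \<longrightarrow>
        trees_containing n (insert (r, v) E) \<inter> trees_containing n (insert (r, w) E) = {}"
      using cayley_tree_forest(1)
      by (fastforce simp: trees_containing_def rooted_forest_def dest: single_valuedD)
  qed auto
  ultimately show ?thesis by simp
qed

lemma card_component_insert_root:
  assumes "rooted_forest n E" "n \<ge> 1" "n \<notin> Domain E"
    and "r \<in> {1..n}" "r \<noteq> n" "r \<notin> Domain E" "v \<notin> component E r"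
  shows "card (component (insert (r, v) E) n) =
    card (component E n) + (if v \<in> component E n then card (component E r) else 0)"
proof -
  have rn: "r \<notin> component E n"
    using assms by (intro distinct_roots_not_connected) (auto simp: rooted_forest_def)
  have fin: "finite (component E x)" if "x \<in> {1..n}" for x
    using component_subset[of E n x] assms(1) that finite_subset
    by (auto simp: rooted_forest_def)
  show ?thesis
  proof (cases "v \<in> component E n")
    case True
    then have "component (insert (r, v) E) n = component E n \<union> component E r"
      using component_eq[OF True] by (auto simp: component_insert)
    then show ?thesis
      using True fin assms component_disjoint[OF rn] by (simp add: card_Un_disjoint)
  qed (use rn in \<open>simp add: component_insert\<close>)
qed

text \<open>
  The factor $n$ on the left avoids the exponent $c - 1$, which is negative if the forest
  is already a Cayley tree.
\<close>

lemma card_trees_containing: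
  assumes "n \<ge> 1" "rooted_forest n E" "n \<notin> Domain E" "card E + c + 1 = n"
  shows "card (trees_containing n E) * n = card (component E n) * n ^ c"
  using assms
proof (induction c arbitrary: E)
  case 0
  then show ?case using spanning_forest[of n E] by simp
next
  case (Suc c)
  have E: "E \<subseteq> {1..n} \<times> {1..n}" "single_valued E" "finite E"
    using Suc.prems(2) rooted_forest_finite by (auto simp: rooted_forest_def)
  \<comment> \<open>There are too few edges for all vertices except \<open>n\<close> to have a parent.\<close>
  have "\<not> {1..n} - {n} \<subseteq> Domain E"
  proof
    assume "{1..n} - {n} \<subseteq> Domain E"
    then have "n - 1 \<le> card (Domain E)"
      using Suc.prems(1) E(3) card_mono[of "Domain E" "{1..n} - {n}"]
      by (simp add: finite_Domain)
    then show False using Suc.prems(4) E by (simp add: card_Domain_single_valued)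
  qed
  then obtain r where r: "r \<in> {1..n}" "r \<noteq> n" "r \<notin> Domain E" by blast
  let ?B = "component E n" and ?R = "component E r"
  have rn: "r \<notin> ?B"
    using r Suc.prems by (intro distinct_roots_not_connected) (auto simp: rooted_forest_def)
  have sub: "?B \<subseteq> {1..n}" "?R \<subseteq> {1..n}"
    using component_subset[OF E(1)] r Suc.prems(1) by auto
  have fin: "finite ?B" "finite ?R" using sub finite_subset by blast+
  have disj: "?B \<inter> ?R = {}" using component_disjoint[OF rn] .
  have card_parts: "card ?B + card ?R + card ({1..n} - ?R - ?B) = n"
  proof -
    have "card (?B \<union> ?R \<union> ({1..n} - ?R - ?B)) = card ?B + card ?R + card ({1..n} - ?R - ?B)"
      using fin disj by (subst card_Un_disjoint; auto simp: card_Un_disjoint)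
    moreover have "?B \<union> ?R \<union> ({1..n} - ?R - ?B) = {1..n}" using sub by auto
    ultimately show ?thesis by simp
  qed
  have IH: "card (trees_containing n (insert (r, v) E)) * n =
      (card ?B + (if v \<in> ?B then card ?R else 0)) * n ^ c"
    if v: "v \<in> {1..n} - ?R" for v
  proof -
    have "(r, v) \<notin> E" using r by auto
    then have "card (insert (r, v) E) + c + 1 = n" using Suc.prems(4) E(3) by simp
    moreover have "rooted_forest n (insert (r, v) E)"
      using rooted_forest_insert[OF Suc.prems(2)] r v by auto
    ultimately show ?thesis
      using Suc.IH[of "insert (r, v) E"] Suc.prems r v
        card_component_insert_root[OF Suc.prems(2,1,3) r, of v] by auto
  qed
  have "card (trees_containing n E) * n =
      (\<Sum>v\<in>{1..n} - ?R. (card ?B + (if v \<in> ?B then card ?R else 0)) * n ^ c)"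
    using IH by (simp add: card_trees_containing_split[OF Suc.prems(2) r] sum_distrib_right)
  \<comment> \<open>Only a parent in the component of \<open>n\<close> enlarges this component.\<close>
  also have "{1..n} - ?R = ?B \<union> ({1..n} - ?R - ?B)" using sub disj by auto
  also have "(\<Sum>v\<in>\<dots>. (card ?B + (if v \<in> ?B then card ?R else 0)) * n ^ c) =
      (\<Sum>v\<in>?B. (card ?B + card ?R) * n ^ c) + (\<Sum>v\<in>{1..n} - ?R - ?B. card ?B * n ^ c)"
    using fin by (subst sum.union_disjoint) (auto intro!: arg_cong2[where f="(+)"] sum.cong)
  also have "\<dots> = card ?B * n ^ c * (card ?B + card ?R + card ({1..n} - ?R - ?B))"
    by (simp add: algebra_simps)
  also have "\<dots> = card ?B * n ^ Suc c" using card_parts by simp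
  finally show ?case .
qed

section \<open>Forests reached by the exploration\<close>

text \<open>
  A peeling algorithm is constrained only on marked forests with fewer than $n - 1$ edges; the
  hypotheses place \<open>f\<close> among these.
\<close>

lemma peeled_vertex:
  assumes "peeling_algorithm n a" "n \<ge> 1" "rooted_forest n (edges f)"
    and "card (edges f) + 2 \<le> n" "blue f = component (edges f) n"
  shows "a f \<in> {1..n}" "a f \<noteq> n" "a f \<notin> Domain (edges f)" "a f \<notin> component (edges f) n"
proof -
  have "f \<in> marked_forests n (card (edges f))"
    using assms by (auto simp: marked_forests_def)
  then have "f \<in> all_marked_forests n - marked_forests n (n - 1)"
    using assms(4) by (auto simp: all_marked_forests_def marked_forests_def)
  then have "a f \<in> white n f \<inter> roots n (edges f)"
    using assms(1) by (auto simp: peeling_algorithm_def)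
  then show "a f \<in> {1..n}" "a f \<noteq> n" "a f \<notin> Domain (edges f)" "a f \<notin> component (edges f) n"
    using assms(5) by (auto simp: white_def roots_def)
qed

lemma attach_simps [simp]:
  "edges (attach f u v) = insert (u, v) (edges f)"
  "blue (attach f u v) = (if v \<in> blue f then component (insert (u, v) (edges f)) v else blue f)"
  by (simp_all add: attach_def Let_def)

lemma blue_attach:
  assumes "blue f = component (edges f) n" "u \<notin> blue f"
  shows "blue (attach f u v) = component (edges (attach f u v)) n"
proof (cases "v \<in> blue f")
  case True
  then have "component (edges f) v = component (edges f) n"
    using assms(1) component_eq by blast
  then show ?thesis using True assms(1) by (simp add: component_insert)
next
  case False
  then show ?thesis using assms by (simp add: component_insert)
qed

text \<open>
  The blue tree is the component of $n$ throughout, so the edges alone determine the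
  state of the exploration.
\<close>

lemma exploration_invariant:
  assumes "peeling_algorithm n a" "n \<ge> 1" "t \<in> cayley_trees n" "i + 1 \<le> n"
  shows "edges (exploration n a t i) \<subseteq> t \<and> card (edges (exploration n a t i)) = i \<and>
    blue (exploration n a t i) = component (edges (exploration n a t i)) n"
  using assms(4)
proof (induction i)
  case 0
  then show ?case by (auto simp: component_def)
next
  case (Suc i)
  let ?f = "exploration n a t i"
  have IH: "edges ?f \<subseteq> t" "card (edges ?f) = i" "blue ?f = component (edges ?f) n"
    using Suc by auto
  have forest: "rooted_forest n (edges ?f)"
    using IH(1) cayley_tree_forest(1)[OF assms(3)] rooted_forest_subset by blast
  note a = peeled_vertex[OF assms(1,2) forest _ IH(3)]
  have r: "a ?f \<in> {1..n}" "a ?f \<noteq> n" "a ?f \<notin> Domain (edges ?f)" "a ?f \<notin> component (edges ?f) n"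
    using a IH(2) Suc.prems by auto
  have "(a ?f, parent t (a ?f)) \<in> t"
    using parent_eq_iff[OF assms(3) r(1,2)] by blast
  moreover have "(a ?f, parent t (a ?f)) \<notin> edges ?f" using r(3) by auto
  moreover note blue_attach[OF IH(3)] r(4)
  ultimately show ?case
    using IH rooted_forest_finite[OF forest] by (simp add: Let_def del: attach_simps(2))
qed

lemma exploration_peeled_vertex:
  assumes "peeling_algorithm n a" "n \<ge> 1" "t \<in> cayley_trees n" "i + 2 \<le> n"
    and "f = exploration n a t i"
  shows "rooted_forest n (edges f)" "n \<notin> Domain (edges f)"
    "a f \<in> {1..n}" "a f \<noteq> n" "a f \<notin> Domain (edges f)" "a f \<notin> component (edges f) n"
proof -
  have I: "edges f \<subseteq> t" "card (edges f) = i" "blue f = component (edges f) n"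
    using exploration_invariant[OF assms(1-3), of i] assms(4,5) by auto
  show f: "rooted_forest n (edges f)" "n \<notin> Domain (edges f)"
    using I(1) cayley_tree_forest[OF assms(3)] rooted_forest_subset by blast+
  show "a f \<in> {1..n}" "a f \<noteq> n" "a f \<notin> Domain (edges f)" "a f \<notin> component (edges f) n"
    using peeled_vertex[OF assms(1,2) f(1) _ I(3)] I(2) assms(4) by auto
qed

lemma exploration_in_marked_forests:
  assumes "peeling_algorithm n a" "n \<ge> 1" "t \<in> cayley_trees n" "i + 1 \<le> n"
  shows "exploration n a t i \<in> all_marked_forests n"
proof -
  have "rooted_forest n (edges (exploration n a t i))"
    using exploration_invariant[OF assms] cayley_tree_forest(1)[OF assms(3)] rooted_forest_subset
    by blast
  then have "exploration n a t i \<in> marked_forests n i"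
    using exploration_invariant[OF assms] assms(2) by (auto simp: marked_forests_def)
  then show ?thesis using assms(4) by (auto simp: all_marked_forests_def)
qed

lemma edges_exploration_mono:
  "i \<le> j \<Longrightarrow> edges (exploration n a t i) \<subseteq> edges (exploration n a t j)"
  by (induction rule: dec_induct) (auto simp: Let_def)

text \<open>
  The answers given by \<open>t\<close> are the edges of the explored forest. If \<open>t'\<close> contains them, it gives the
  same answers, and then the algorithm goes on to ask the same questions.
\<close>

lemma exploration_eq_if_edges_subset:
  assumes "peeling_algorithm n a" "n \<ge> 1" "t \<in> cayley_trees n" "t' \<in> cayley_trees n"
    and "i + 1 \<le> n" "edges (exploration n a t i) \<subseteq> t'"
  shows "exploration n a t' i = exploration n a t i"
  using assms(5,6)
proof (induction i)
  case 0
  then show ?case by simp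
next
  case (Suc i)
  let ?f = "exploration n a t i"
  have sub: "insert (a ?f, parent t (a ?f)) (edges ?f) \<subseteq> t'"
    using Suc.prems(2) by (simp add: Let_def)
  then have eq: "exploration n a t' i = ?f" using Suc by auto
  have "a ?f \<in> {1..n}" "a ?f \<noteq> n"
    using exploration_peeled_vertex[OF assms(1-3) _ refl, of i] Suc.prems(1) by auto
  then have "parent t' (a ?f) = parent t (a ?f)"
    using parent_eq_iff[OF assms(4)] sub by auto
  then show ?case using eq by (simp add: Let_def)
qed

lemma exploration_eq_iff:
  assumes "peeling_algorithm n a" "n \<ge> 1" "t \<in> cayley_trees n" "t' \<in> cayley_trees n" "i + 1 \<le> n"
  shows "exploration n a t' i = exploration n a t i \<longleftrightarrow> edges (exploration n a t i) \<subseteq> t'"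
  using exploration_eq_if_edges_subset[OF assms] exploration_invariant[OF assms(1,2,4,5)] by metis

text \<open>
  Earlier forests have fewer edges, so a tree that contains the edges of the present forest
  agrees with \<open>t\<close> at all previous steps.
\<close>

lemma exploration_determines_past:
  assumes "peeling_algorithm n a" "n \<ge> 1" "t \<in> cayley_trees n" "t' \<in> cayley_trees n"
    and "i + 1 \<le> n" "exploration n a t' i = exploration n a t i" "j \<le> i"
  shows "exploration n a t' j = exploration n a t j"
proof -
  have "edges (exploration n a t j) \<subseteq> t'"
    using edges_exploration_mono[OF assms(7)] exploration_invariant[OF assms(1,2,4,5)] assms(6)
    by (metis order_trans)
  then show ?thesis using exploration_eq_iff[OF assms(1-4), of j] assms(5,7) by auto
qed

section \<open>The uniform tree\<close>

lemma uniform_prob_eq_card: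
  assumes "T \<in> M \<rightarrow>\<^sub>M count_space C" "distr M (count_space C) T = uniform_count_measure C"
    and "finite C"
  shows "\<P>(\<omega> in M. Q (T \<omega>)) = card {t \<in> C. Q t} / card C"
proof -
  have "{\<omega> \<in> space M. Q (T \<omega>)} = T -` {t \<in> C. Q t} \<inter> space M"
    using measurable_space[OF assms(1)] by auto
  then have "\<P>(\<omega> in M. Q (T \<omega>)) = measure (distr M (count_space C) T) {t \<in> C. Q t}"
    using assms(1) by (simp add: measure_distr)
  also have "\<dots> = card {t \<in> C. Q t} / card C"
    using assms(2,3) by (simp add: measure_uniform_count_measure)
  finally show ?thesis .
qed

lemma cond_prob_uniform_eq_card:
  assumes "T \<in> M \<rightarrow>\<^sub>M count_space C" "distr M (count_space C) T = uniform_count_measure C"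
    and "finite C"
  shows "\<P>(\<omega> in M. P (T \<omega>) \<bar> Q (T \<omega>)) = card {t \<in> C. P t \<and> Q t} / card {t \<in> C. Q t}"
proof (cases "C = {}")
  case False
  then show ?thesis
    using uniform_prob_eq_card[OF assms, of Q] uniform_prob_eq_card[OF assms, of "\<lambda>t. P t \<and> Q t"]
      assms(3) by (simp add: cond_prob_def)
qed (simp add: cond_prob_def uniform_prob_eq_card[OF assms])

text \<open>
  Since the present forest determines the past ones, conditioning on the present or on the whole past is conditioning on the same event.
\<close>

lemma exploration_markov_chain:
  assumes "n \<ge> 1" "peeling_algorithm n a" "prob_space M"
    and "T \<in> M \<rightarrow>\<^sub>M count_space (cayley_trees n)"
  shows "markov_chain M (all_marked_forests n) (n - 1) (\<lambda>i \<omega>. exploration n a (T \<omega>) i)"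
  unfolding markov_chain_def
proof (intro conjI allI impI ballI)
  have T: "T \<omega> \<in> cayley_trees n" if "\<omega> \<in> space M" for \<omega>
    using measurable_space[OF assms(4) that] by simp
  show "prob_space M" by fact
  show "countable (all_marked_forests n)"
  proof -
    have "all_marked_forests n \<subseteq>
        (\<lambda>(E, v). \<lparr>edges = E, blue = component E v\<rparr>) ` (Pow ({1..n} \<times> {1..n}) \<times> {1..n})"
    proof
      fix f assume "f \<in> all_marked_forests n"
      then obtain v where "edges f \<subseteq> {1..n} \<times> {1..n}" "v \<in> {1..n}" "blue f = component (edges f) v"
        by (auto simp: all_marked_forests_def marked_forests_def rooted_forest_def)
      then show "f \<in> (\<lambda>(E, v). \<lparr>edges = E, blue = component E v\<rparr>) `
          (Pow ({1..n} \<times> {1..n}) \<times> {1..n})"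
        by (intro image_eqI[of _ _ "(edges f, v)"]) auto
    qed
    then show ?thesis
      by (rule countable_subset) (intro countable_finite finite_imageI; simp)
  qed
  show "(\<lambda>\<omega>. exploration n a (T \<omega>) i) \<in> M \<rightarrow>\<^sub>M count_space (all_marked_forests n)"
    if "i \<le> n - 1" for i
    by (rule measurable_compose[OF assms(4)])
      (use exploration_in_marked_forests[OF assms(2,1)] assms(1) that in auto)
  fix i x s
  assume i: "i < n - 1"
    and pos: "0 < \<P>(\<omega> in M. \<forall>j\<le>i. exploration n a (T \<omega>) j = x j)"
  have "{\<omega> \<in> space M. \<forall>j\<le>i. exploration n a (T \<omega>) j = x j} \<noteq> {}"
    using pos by (metis measure_empty less_irrefl)
  then obtain \<omega>0 where w0: "\<omega>0 \<in> space M" "\<And>j. j \<le> i \<Longrightarrow> exploration n a (T \<omega>0) j = x j"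
    by auto
  have past: "(\<forall>j\<le>i. exploration n a (T \<omega>) j = x j) \<longleftrightarrow> exploration n a (T \<omega>) i = x i"
    if "\<omega> \<in> space M" for \<omega>
  proof
    assume "exploration n a (T \<omega>) i = x i"
    then have "exploration n a (T \<omega>) i = exploration n a (T \<omega>0) i" using w0(2) by simp
    from exploration_determines_past[OF assms(2,1) T[OF w0(1)] T[OF that] _ this]
    show "\<forall>j\<le>i. exploration n a (T \<omega>) j = x j" using i w0(2) by simp
  qed simp
  have "\<P>(\<omega> in M. P \<omega> \<and> (\<forall>j\<le>i. exploration n a (T \<omega>) j = x j)) =
      \<P>(\<omega> in M. P \<omega> \<and> exploration n a (T \<omega>) i = x i)" for P
    by (rule arg_cong[where f = "measure M"], rule Collect_cong) (use past in blast)
  from this[of "\<lambda>\<omega>. exploration n a (T \<omega>) (Suc i) = s"] this[of "\<lambda>_. True"]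
  show "\<P>(\<omega> in M. exploration n a (T \<omega>) (Suc i) = s \<bar> \<forall>j\<le>i. exploration n a (T \<omega>) j = x j) =
      \<P>(\<omega> in M. exploration n a (T \<omega>) (Suc i) = s \<bar> exploration n a (T \<omega>) i = x i)"
    unfolding cond_prob_def by simp
qed

text \<open>
  The transition probabilities for blue and white \<open>v\<close> at once. The tree \<open>t\<close> witnesses that \<open>f\<close> can be
  reached.
\<close>

lemma prob_parent_given_forest:
  assumes "n \<ge> 1" "peeling_algorithm n a"
    and "T \<in> M \<rightarrow>\<^sub>M count_space (cayley_trees n)"
    and "distr M (count_space (cayley_trees n)) T = uniform_count_measure (cayley_trees n)"
    and "t \<in> cayley_trees n" "i + 2 \<le> n" "f = exploration n a t i" "r = a f"
    and "v \<in> {1..n}" "v \<notin> component (edges f) r"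
  shows "\<P>(\<omega> in M. parent (T \<omega>) r = v \<bar> exploration n a (T \<omega>) i = f \<and> a (exploration n a (T \<omega>) i) = r)
    = (card (component (edges f) n)
        + (if v \<in> component (edges f) n then card (component (edges f) r) else 0))
      / (card (component (edges f) n) * n)"
proof -
  let ?E = "edges f"
  let ?E' = "insert (r, v) ?E"
  \<comment> \<open>After the edge from \<open>r\<close> is added, \<open>c\<close> components other than that of \<open>n\<close> are left.\<close>
  obtain c where c: "i + c + 2 = n" using assms(6) by (metis add.commute add.left_commute le_Suc_ex)
  note pv = exploration_peeled_vertex[OF assms(2,1,5-7)]
  have card_E: "card ?E = i"
    using exploration_invariant[OF assms(2,1,5), of i] assms(6,7) by auto
  have iff: "exploration n a t' i = f \<longleftrightarrow> ?E \<subseteq> t'" if "t' \<in> cayley_trees n" for t'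
    using exploration_eq_iff[OF assms(2,1,5) that, of i] assms(6,7) by auto
  have par: "parent t' r = v \<longleftrightarrow> (r, v) \<in> t'" if "t' \<in> cayley_trees n" for t'
    using parent_eq_iff[OF that pv(3,4)] assms(8) by simp
  have ev: "{t' \<in> cayley_trees n. exploration n a t' i = f \<and> a (exploration n a t' i) = r}
      = trees_containing n ?E"
    using iff assms(8) by (auto simp: trees_containing_def)
  have ev': "{t' \<in> cayley_trees n. parent t' r = v \<and>
        exploration n a t' i = f \<and> a (exploration n a t' i) = r} = trees_containing n ?E'"
    using iff par assms(8) by (auto simp: trees_containing_def)
  have forest': "rooted_forest n ?E'"
    using rooted_forest_insert pv assms(8-10) by auto
  have "(r, v) \<notin> ?E" using pv(5) assms(8) by auto
  then have "card ?E' = i + 1" using card_E rooted_forest_finite[OF pv(1)] by simp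
  then have N': "card (trees_containing n ?E') * n = card (component ?E' n) * n ^ c"
    using card_trees_containing[OF assms(1) forest', of c] pv c assms(8) by auto
  have N: "card (trees_containing n ?E) * n = card (component ?E n) * n ^ Suc c"
    using card_trees_containing[OF assms(1) pv(1,2), of "Suc c"] c card_E by auto
  have l: "card (component ?E n) > 0"
    using component_subset[of ?E n n] pv(1) assms(1)
    by (auto simp: rooted_forest_def card_gt_0_iff intro: finite_subset component_refl)
  have n: "real n > 0" using assms(1) by simp
  have "\<P>(\<omega> in M. parent (T \<omega>) r = v \<bar> exploration n a (T \<omega>) i = f \<and> a (exploration n a (T \<omega>) i) = r)
      = card (trees_containing n ?E') / card (trees_containing n ?E)"
    using cond_prob_uniform_eq_card[OF assms(3,4) finite_cayley_trees, of "\<lambda>t. parent t r = v"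
        "\<lambda>t. exploration n a t i = f \<and> a (exploration n a t i) = r"]
    unfolding ev ev' .
  \<comment> \<open>Expanding by \<open>n\<close> brings both counts into the form of \<open>card_trees_containing\<close>.\<close>
  also have "\<dots> = real (card (trees_containing n ?E') * n) / real (card (trees_containing n ?E) * n)"
    using n by simp
  also have "\<dots> = card (component ?E' n) / (card (component ?E n) * n)"
    unfolding N N' using n l by (simp add: field_simps)
  also have "card (component ?E' n) = card (component ?E n)
      + (if v \<in> component ?E n then card (component ?E r) else 0)"
    using card_component_insert_root[OF pv(1) assms(1) pv(2)] pv(3-5) assms(8,10) by auto
  finally show ?thesis by simp
qed

theorem proposition1:
  fixes n :: nat
    and a :: "marked_forest \<Rightarrow> nat"
    and M :: "'w measure"
    and T :: "'w \<Rightarrow> (nat \<times> nat) set"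
    and F :: "nat \<Rightarrow> 'w \<Rightarrow> marked_forest"
  assumes "n \<ge> 1"
    and "peeling_algorithm n a"
    and "prob_space M"
    and "T \<in> M \<rightarrow>\<^sub>M count_space (cayley_trees n)"
    and "distr M (count_space (cayley_trees n)) T = uniform_count_measure (cayley_trees n)"
    and "F = (\<lambda>i \<omega>. exploration n a (T \<omega>) i)"
  shows "markov_chain M (all_marked_forests n) (n - 1) F \<and>
    (\<forall>i f r. i + 2 \<le> n \<and> \<P>(\<omega> in M. F i \<omega> = f \<and> a (F i \<omega>) = r) > 0 \<longrightarrow>
      (let m = card (component (edges f) r); l = card (blue f) in
        m \<ge> 1 \<and> l \<ge> 1 \<and>
        (\<forall>v \<in> blue f.
           \<P>(\<omega> in M. parent (T \<omega>) r = v \<bar> F i \<omega> = f \<and> a (F i \<omega>) = r)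
             = (real l + real m) / (real l * real n) \<and>
           (\<forall>\<omega> \<in> space M. F i \<omega> = f \<and> a (F i \<omega>) = r \<and> parent (T \<omega>) r = v \<longrightarrow>
              edges (F (Suc i) \<omega>) = insert (r, v) (edges f) \<and>
              blue (F (Suc i) \<omega>) = component (edges (F (Suc i) \<omega>)) r)) \<and>
        (\<forall>v \<in> white n f - component (edges f) r.
           \<P>(\<omega> in M. parent (T \<omega>) r = v \<bar> F i \<omega> = f \<and> a (F i \<omega>) = r) = 1 / real n \<and>
           (\<forall>\<omega> \<in> space M. F i \<omega> = f \<and> a (F i \<omega>) = r \<and> parent (T \<omega>) r = v \<longrightarrow>
              edges (F (Suc i) \<omega>) = insert (r, v) (edges f) \<and>
              blue (F (Suc i) \<omega>) = blue f \<and>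
              component (edges (F (Suc i) \<omega>)) r \<subseteq> white n (F (Suc i) \<omega>)))))"
proof -
  note n = assms(1) and pa = assms(2) and law = assms(4,5)
  have T: "T \<omega> \<in> cayley_trees n" if "\<omega> \<in> space M" for \<omega>
    using measurable_space[OF assms(4) that] by simp
  have mc: "markov_chain M (all_marked_forests n) (n - 1) F"
    unfolding assms(6) using exploration_markov_chain[OF assms(1-4)] .
  show ?thesis
    unfolding Let_def
  proof (rule conjI[OF mc], intro allI impI, elim conjE)
    fix i f r
    assume i: "i + 2 \<le> n" and pos: "0 < \<P>(\<omega> in M. F i \<omega> = f \<and> a (F i \<omega>) = r)"
    have "{\<omega> \<in> space M. F i \<omega> = f \<and> a (F i \<omega>) = r} \<noteq> {}"
      using pos by (metis measure_empty less_irrefl)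
    then obtain \<omega>0 where w0: "\<omega>0 \<in> space M" "f = exploration n a (T \<omega>0) i" "r = a f"
      by (auto simp: assms(6))
    note t = T[OF w0(1)]
    note pv = exploration_peeled_vertex[OF pa n t i w0(2), folded w0(3)]
    have blue: "blue f = component (edges f) n"
      using exploration_invariant[OF pa n t, of i] i w0(2) by auto
    have rb: "r \<notin> blue f" using blue pv by simp
    have sub: "edges f \<subseteq> {1..n} \<times> {1..n}" using pv(1) by (simp add: rooted_forest_def)
    have comp_sub: "component (edges f) x \<subseteq> {1..n}" if "x \<in> {1..n}" for x
      using component_subset[OF sub that] .
    have comp_card: "card (component (edges f) x) \<ge> 1" if "x \<in> {1..n}" for x
      using comp_sub[OF that] component_refl[of x "edges f"]
      by (metis One_nat_def Suc_leI card_gt_0_iff empty_iff finite_atLeastAtMost finite_subset)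
    have prob: "\<P>(\<omega> in M. parent (T \<omega>) r = v \<bar> F i \<omega> = f \<and> a (F i \<omega>) = r)
        = (card (blue f) + (if v \<in> blue f then card (component (edges f) r) else 0))
          / (card (blue f) * n)"
      if "v \<in> {1..n}" "v \<notin> component (edges f) r" for v
      using prob_parent_given_forest[OF n pa law t i w0(2,3) that] by (simp add: assms(6) blue)
    have next_forest: "F (Suc i) \<omega> = attach f r v"
      if "F i \<omega> = f" "parent (T \<omega>) r = v" for \<omega> v
      using that w0(3) by (simp add: assms(6) Let_def)
    have blue_far: "v \<notin> component (edges f) r" if "v \<in> blue f" for v
      using that rb blue component_sym component_trans by metis
    show "1 \<le> card (component (edges f) r) \<and> 1 \<le> card (blue f) \<and>
        (\<forall>v \<in> blue f.
           \<P>(\<omega> in M. parent (T \<omega>) r = v \<bar> F i \<omega> = f \<and> a (F i \<omega>) = r)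
             = (real (card (blue f)) + real (card (component (edges f) r)))
               / (real (card (blue f)) * real n) \<and>
           (\<forall>\<omega> \<in> space M. F i \<omega> = f \<and> a (F i \<omega>) = r \<and> parent (T \<omega>) r = v \<longrightarrow>
              edges (F (Suc i) \<omega>) = insert (r, v) (edges f) \<and>
              blue (F (Suc i) \<omega>) = component (edges (F (Suc i) \<omega>)) r)) \<and>
        (\<forall>v \<in> white n f - component (edges f) r.
           \<P>(\<omega> in M. parent (T \<omega>) r = v \<bar> F i \<omega> = f \<and> a (F i \<omega>) = r) = 1 / real n \<and>
           (\<forall>\<omega> \<in> space M. F i \<omega> = f \<and> a (F i \<omega>) = r \<and> parent (T \<omega>) r = v \<longrightarrow>
              edges (F (Suc i) \<omega>) = insert (r, v) (edges f) \<and>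
              blue (F (Suc i) \<omega>) = blue f \<and>
              component (edges (F (Suc i) \<omega>)) r \<subseteq> white n (F (Suc i) \<omega>)))"
    proof (intro conjI ballI impI; (elim conjE)?)
      show "1 \<le> card (component (edges f) r)" using comp_card pv(3) .
      show l: "1 \<le> card (blue f)" using comp_card[of n] n blue by simp
      {
        fix v assume v: "v \<in> blue f"
        then have "v \<in> {1..n}" using comp_sub[of n] n blue by auto
        then show "\<P>(\<omega> in M. parent (T \<omega>) r = v \<bar> F i \<omega> = f \<and> a (F i \<omega>) = r)
             = (real (card (blue f)) + real (card (component (edges f) r)))
               / (real (card (blue f)) * real n)"
          using prob[OF _ blue_far[OF v]] v by simp
        fix \<omega> assume "F i \<omega> = f" "parent (T \<omega>) r = v"
        note nf = next_forest[OF this]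
        then show "edges (F (Suc i) \<omega>) = insert (r, v) (edges f)" by simp
        show "blue (F (Suc i) \<omega>) = component (edges (F (Suc i) \<omega>)) r"
          using nf v by (simp add: component_insert)
      }
      {
        fix v assume v: "v \<in> white n f - component (edges f) r"
        then have vn: "v \<in> {1..n}" "v \<notin> blue f" "v \<notin> component (edges f) r"
          by (auto simp: white_def)
        then show "\<P>(\<omega> in M. parent (T \<omega>) r = v \<bar> F i \<omega> = f \<and> a (F i \<omega>) = r) = 1 / real n"
          using prob[OF vn(1,3)] l by simp
        fix \<omega> assume "F i \<omega> = f" "parent (T \<omega>) r = v"
        note nf = next_forest[OF this]
        then show "edges (F (Suc i) \<omega>) = insert (r, v) (edges f)" by simp
        show "blue (F (Suc i) \<omega>) = blue f" using nf vn by simp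
        have "component (edges f) r \<inter> blue f = {}" "component (edges f) v \<inter> blue f = {}"
          using rb vn(2) blue component_disjoint by blast+
        then show "component (edges (F (Suc i) \<omega>)) r \<subseteq> white n (F (Suc i) \<omega>)"
          using nf vn comp_sub[OF pv(3)] comp_sub[OF vn(1)]
          by (auto simp: component_insert white_def)
      }
    qed
  qed
qed

end
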